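(* Let $G=\mathbb{R}^3=\{(x,y,z)\}$ be the Heisenberg group with the left-invariant vector fields $$X_1=\frac{\partial}{\partial x}-\frac y2\frac{\partial}{\partial z},\qquad X_2=\frac{\partial}{\partial y}+\frac x2\frac{\partial}{\partial z},\qquad X_3=\frac{\partial}{\partial z},$$ and consider the control system $$\dot q=\sum_{i=1}^3u_iX_i(q),\qquad q\in G,$$ $$u\in U=\{(u_1,u_2,u_3)\in\mathbb{R}^3\mid u_1^2+u_2^2-u_3^2\le 0,\ u_3\ge 0\},$$ with the length functional $$J(q(\cdot))=\int_0^{t_1}\sqrt{u_3^2-u_1^2-u_2^2}\,dt.$$ For all points $q_0,q_1\in G$ the Lorentzian distance from $q_0$ to $q_1$ is $d(q_0,q_1)=+\infty$. Consequently there is no Lorentzian longest curve connecting $q_0$ to $q_1$.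
   Context: In coordinates the system is $\dot x=u_1$, $\dot y=u_2$, $\dot z=-\frac y2u_1+\frac x2u_2+u_3$. An admissible trajectory (future-directed nonspacelike curve) is a Lipschitz curve $q:[0,t_1]\to G$, $t_1\ge 0$ (the terminal time is free), satisfying $\dot q(t)=\sum_{i=1}^3u_i(t)X_i(q(t))$ for almost every $t$, with a measurable essentially bounded control $u:[0,t_1]\to U$. For $q_0,q_1\in G$ let $\Omega_{q_0q_1}$ be the set of all admissible trajectories from $q_0$ to $q_1$. The Lorentzian distance is $d(q_0,q_1)=\sup\{J(\gamma)\mid\gamma\in\Omega_{q_0q_1}\}\in[0,+\infty]$ if $\Omega_{q_0q_1}\neq\emptyset$, and $d(q_0,q_1)=0$ if $\Omega_{q_0q_1}=\emptyset$. A Lorentzian longest curve connecting $q_0$ to $q_1$ is a trajectory $\gamma\in\Omega_{q_0q_1}$ with $J(\gamma)=d(q_0,q_1)$. *)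

theory Defs
  imports "HOL-Analysis.Analysis"
begin

type_synonym point = "real^3"

definition heis_mult :: "point \<Rightarrow> point \<Rightarrow> point"
  where "heis_mult g q = vector [g$1 + q$1, g$2 + q$2, g$3 + q$3 + (g$1 * q$2 - g$2 * q$1) / 2]"

definition X1 :: "point \<Rightarrow> real^3"
  where "X1 q = vector [1, 0, - (q$2) / 2]"

definition X2 :: "point \<Rightarrow> real^3"
  where "X2 q = vector [0, 1, q$1 / 2]"

definition X3 :: "point \<Rightarrow> real^3"
  where "X3 q = vector [0, 0, 1]"

definition left_invariant :: "(point \<Rightarrow> real^3) \<Rightarrow> bool"
  where "left_invariant V \<longleftrightarrow>
    (\<forall>g q. \<exists>D. (heis_mult g has_derivative D) (at q) \<and> D (V q) = V (heis_mult g q))"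

definition U :: "(real^3) set"
  where "U = {u. (u$1)\<^sup>2 + (u$2)\<^sup>2 - (u$3)\<^sup>2 \<le> 0 \<and> u$3 \<ge> 0}"

definition velocity :: "point \<Rightarrow> real^3 \<Rightarrow> real^3"
  where "velocity q u = (u$1) *\<^sub>R X1 q + (u$2) *\<^sub>R X2 q + (u$3) *\<^sub>R X3 q"

definition is_control :: "real \<Rightarrow> (real \<Rightarrow> point) \<Rightarrow> (real \<Rightarrow> real^3) \<Rightarrow> bool"
  where "is_control t1 q u \<longleftrightarrow>
    u \<in> {0..t1} \<rightarrow> U \<and>
    u \<in> borel_measurable (lebesgue_on {0..t1}) \<and>
    (\<exists>B. AE t in lebesgue_on {0..t1}. norm (u t) \<le> B) \<and>
    (AE t in lebesgue_on {0..t1}.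
       (q has_vector_derivative velocity (q t) (u t)) (at t within {0..t1}))"

text \<open>A curve \<open>q : [0, t\<^sub>1] \<rightarrow> G\<close> is represented by the pair of its terminal time
  and a total function whose values outside \<open>[0, t\<^sub>1]\<close> are irrelevant.\<close>

type_synonym curve = "real \<times> (real \<Rightarrow> point)"

definition admissible :: "curve \<Rightarrow> bool"
  where "admissible = (\<lambda>(t1, q).
    0 \<le> t1 \<and> (\<exists>L. L-lipschitz_on {0..t1} q) \<and> (\<exists>u. is_control t1 q u))"

definition Omega :: "point \<Rightarrow> point \<Rightarrow> curve set"
  where "Omega q0 q1 = {(t1, q). admissible (t1, q) \<and> q 0 = q0 \<and> q t1 = q1}"

definition control_length :: "real \<Rightarrow> (real \<Rightarrow> real^3) \<Rightarrow> real"
  where "control_length t1 u =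
    (LINT t|lebesgue_on {0..t1}. sqrt ((u t $ 3)\<^sup>2 - (u t $ 1)\<^sup>2 - (u t $ 2)\<^sup>2))"

text \<open>The control of an admissible curve is unique almost everywhere, so the choice does not
  matter: see \<open>J_eq_control_length\<close> below.\<close>

definition J :: "curve \<Rightarrow> real"
  where "J = (\<lambda>(t1, q). control_length t1 (SOME u. is_control t1 q u))"

definition lorentz_dist :: "point \<Rightarrow> point \<Rightarrow> ereal"
  where "lorentz_dist q0 q1 =
    (if Omega q0 q1 = {} then 0 else (SUP \<gamma>\<in>Omega q0 q1. ereal (J \<gamma>)))"

definition longest_curve :: "point \<Rightarrow> point \<Rightarrow> curve \<Rightarrow> bool"
  where "longest_curve q0 q1 \<gamma> \<longleftrightarrow> \<gamma> \<in> Omega q0 q1 \<and> ereal (J \<gamma>) = lorentz_dist q0 q1"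

lemma has_derivative_heis_mult:
  "(heis_mult g has_derivative (\<lambda>v. vector [v$1, v$2, v$3 + (g$1 * v$2 - g$2 * v$1) / 2])) (at q)"
proof -
  have eq: "heis_mult g = (\<lambda>q. g + vector [q$1, q$2, q$3 + (g$1 * q$2 - g$2 * q$1) / 2])"
    by (auto simp: heis_mult_def fun_eq_iff vec_eq_iff forall_3)
  have "linear (\<lambda>v::real^3. vector [v$1, v$2, v$3 + (g$1 * v$2 - g$2 * v$1) / 2] :: real^3)"
    by (rule linearI) (simp_all add: vec_eq_iff forall_3 field_simps)
  then show ?thesis
    unfolding eq
    by (auto intro!: derivative_eq_intros bounded_linear_imp_has_derivative
        simp: linear_conv_bounded_linear)
qed

lemma left_invariant_X: "left_invariant X1" "left_invariant X2" "left_invariant X3"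
  unfolding left_invariant_def
  by (intro allI exI conjI, rule has_derivative_heis_mult,
      simp add: heis_mult_def X1_def X2_def X3_def vec_eq_iff forall_3 field_simps)+

lemma velocity_inj: "velocity q u = velocity q v \<longleftrightarrow> u = v"
  by (auto simp: velocity_def X1_def X2_def X3_def vec_eq_iff forall_3)

lemma control_unique_AE:
  assumes "is_control t1 q u" "is_control t1 q v"
  shows "AE t in lebesgue_on {0..t1}. u t = v t"
proof (cases "0 < t1")
  case True
  have "AE t in lebesgue_on {0..t1}. t \<in> {0..t1}"
    using AE_space[of "lebesgue_on {0..t1}"] by simp
  moreover have "AE t in lebesgue_on {0..t1}.
      (q has_vector_derivative velocity (q t) (u t)) (at t within {0..t1})"
    "AE t in lebesgue_on {0..t1}.
      (q has_vector_derivative velocity (q t) (v t)) (at t within {0..t1})"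
    using assms by (auto simp: is_control_def)
  ultimately show ?thesis
  proof eventually_elim
    case (elim t)
    then have "velocity (q t) (u t) = velocity (q t) (v t)"
      using True vector_derivative_unique_within_closed_interval[of 0 t1 t q]
      by (simp add: cbox_interval)
    then show ?case by (simp add: velocity_inj)
  qed
next
  case False
  then have "{0..t1} \<subseteq> {0}" by auto
  then have "negligible {0..t1}"
    using negligible_subset by blast
  then have "{0..t1} \<in> null_sets lebesgue"
    by (simp add: negligible_iff_null_sets)
  then have "AE t in lebesgue. t \<notin> {0..t1}"
    by (rule AE_not_in)
  then have "AE t in lebesgue. t \<in> {0..t1} \<longrightarrow> u t = v t"
    by (rule eventually_mono) blast
  then show ?thesis by (simp add: AE_restrict_space_iff)
qed

lemma J_eq_control_length:
  assumes "is_control t1 q u"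
  shows "J (t1, q) = control_length t1 u"
proof -
  define v where "v = (SOME u. is_control t1 q u)"
  have v: "is_control t1 q v"
    unfolding v_def by (rule someI[of "is_control t1 q", OF assms])
  have [measurable]: "u \<in> borel_measurable (lebesgue_on {0..t1})"
    "v \<in> borel_measurable (lebesgue_on {0..t1})"
    using assms v by (auto simp: is_control_def)
  have nth: "(\<lambda>t. w t $ i) \<in> borel_measurable (lebesgue_on {0..t1})"
    if "w \<in> borel_measurable (lebesgue_on {0..t1})" for w :: "real \<Rightarrow> real^3" and i
    by (rule borel_measurable_continuous_on[OF _ that]) (intro continuous_intros)
  have "control_length t1 v = control_length t1 u"
    unfolding control_length_def
  proof (rule integral_cong_AE)
    show "AE t in lebesgue_on {0..t1}.
        sqrt ((v t $ 3)\<^sup>2 - (v t $ 1)\<^sup>2 - (v t $ 2)\<^sup>2) = sqrt ((u t $ 3)\<^sup>2 - (u t $ 1)\<^sup>2 - (u t $ 2)\<^sup>2)"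
      using control_unique_AE[OF v assms] by eventually_elim simp
  qed (use nth in measurable)
  then show ?thesis by (simp add: J_def v_def)
qed

end

theory Submission
  imports Defs "HOL-Real_Asymp.Real_Asymp"
begin

text \<open>
  A closed planar loop of size \<open>R\<close>, run through clockwise, lowers \<open>z\<close> by an amount of order \<open>R\<^sup>2\<close>,
  while its planar velocity is only of order \<open>R\<close>. Superposing such a loop on the straight segment
  between the projections of \<open>q0\<close> and \<open>q1\<close>, one compensates the loss of height by a constant
  \<open>u\<^sub>3\<close> of order \<open>R\<^sup>2\<close>; this control is timelike for large \<open>R\<close>, and its length is unbounded.
\<close>

lemma continuous_control:
  assumes "continuous_on {0..t1} u" "u \<in> {0..t1} \<rightarrow> U"
    and "\<And>t. t \<in> {0..t1} \<Longrightarrow>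
      (q has_vector_derivative velocity (q t) (u t)) (at t within {0..t1})"
  shows "is_control t1 q u"
proof -
  have "u \<in> borel_measurable (lebesgue_on {0..t1})"
    using assms(1) by (simp add: continuous_imp_measurable_on_sets_lebesgue)
  moreover have "bounded (u ` {0..t1})"
    using assms(1) by (intro compact_imp_bounded compact_continuous_image) auto
  then obtain B where "\<And>t. t \<in> {0..t1} \<Longrightarrow> norm (u t) \<le> B"
    unfolding bounded_iff by blast
  then have "AE t in lebesgue_on {0..t1}. norm (u t) \<le> B"
    by (intro AE_I2) simp
  moreover have "AE t in lebesgue_on {0..t1}.
      (q has_vector_derivative velocity (q t) (u t)) (at t within {0..t1})"
    using assms(3) by (intro AE_I2) simp
  ultimately show ?thesis
    using assms(2) unfolding is_control_def by blast
qed

lemma lipschitz_on_continuous_vector_derivative: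
  fixes q :: "real \<Rightarrow> 'a::real_normed_vector"
  assumes "continuous_on {a..b} q'"
    and "\<And>t. t \<in> {a..b} \<Longrightarrow> (q has_vector_derivative q' t) (at t within {a..b})"
  shows "\<exists>L. L-lipschitz_on {a..b} q"
proof -
  have "bounded (q' ` {a..b})"
    using assms(1) by (intro compact_imp_bounded compact_continuous_image) auto
  then obtain B where B: "0 < B" "\<And>t. t \<in> {a..b} \<Longrightarrow> norm (q' t) \<le> B"
    by (auto simp: bounded_pos)
  have "B-lipschitz_on {a..b} q"
  proof (rule bounded_derivative_imp_lipschitz)
    fix t assume t: "t \<in> {a..b}"
    show "(q has_derivative (\<lambda>h. h *\<^sub>R q' t)) (at t within {a..b})"
      using assms(2)[OF t] by (simp add: has_vector_derivative_def)
    show "onorm (\<lambda>h. h *\<^sub>R q' t) \<le> B"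
      using B(2)[OF t] by (intro onorm_le)
        (metis mult.commute mult_right_mono norm_ge_zero norm_scaleR real_norm_def)
  qed (use B in auto)
  then show ?thesis by blast
qed

text \<open>This makes the derivative of an integral curve of a continuous control continuous, hence
  bounded on a compact interval, which gives the Lipschitz condition.\<close>

lemma continuous_on_velocity:
  fixes q u :: "'a::t2_space \<Rightarrow> real^3"
  assumes "continuous_on S q" "continuous_on S u"
  shows "continuous_on S (\<lambda>t. velocity (q t) (u t))"
  unfolding continuous_on_componentwise[where f = "\<lambda>t. velocity (q t) (u t)"]
  using assms
  by (auto simp: velocity_def X1_def X2_def X3_def Basis_vec_def inner_axis
      exhaust_3 forall_3 intro!: continuous_intros)

lemma has_vector_derivative_vec3:
  fixes q :: "real \<Rightarrow> real^3"
  assumes "((\<lambda>t. q t $ 1) has_real_derivative v $ 1) (at t within S)"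
    and "((\<lambda>t. q t $ 2) has_real_derivative v $ 2) (at t within S)"
    and "((\<lambda>t. q t $ 3) has_real_derivative v $ 3) (at t within S)"
  shows "(q has_vector_derivative v) (at t within S)"
proof -
  have "((\<lambda>t. q t $ i) has_derivative (\<lambda>h. (h *\<^sub>R v) $ i)) (at t within S)" for i
    using exhaust_3[of i] assms by (auto simp: has_field_derivative_def mult_commute_abs)
  then show ?thesis
    unfolding has_vector_derivative_def
    by (subst has_derivative_componentwise_within) (auto simp: Basis_vec_def inner_axis)
qed

text \<open>The cross terms in the square of the sum are nonnegative. This reduces the quadratic
  cone condition, with margin \<open>M\<close>, to an inequality linear in the size of the planar
  velocity.\<close>

lemma timelike_estimate:
  fixes a b c M :: real
  assumes "0 \<le> M" "\<bar>a\<bar> + \<bar>b\<bar> + M \<le> c"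
  shows "a\<^sup>2 + b\<^sup>2 + M\<^sup>2 \<le> c\<^sup>2"
proof -
  have "a\<^sup>2 + b\<^sup>2 + M\<^sup>2 \<le> (\<bar>a\<bar> + \<bar>b\<bar> + M)\<^sup>2"
    using assms(1) by (simp add: power2_eq_square algebra_simps)
  also have "\<dots> \<le> c\<^sup>2"
    using assms by (intro power_mono) auto
  finally show ?thesis .
qed

lemma control_length_ge:
  assumes "0 \<le> t1" "continuous_on {0..t1} u"
    and "\<And>t. t \<in> {0..t1} \<Longrightarrow> M \<le> sqrt ((u t $ 3)\<^sup>2 - (u t $ 1)\<^sup>2 - (u t $ 2)\<^sup>2)"
  shows "M * t1 \<le> control_length t1 u"
proof -
  let ?f = "\<lambda>t. sqrt ((u t $ 3)\<^sup>2 - (u t $ 1)\<^sup>2 - (u t $ 2)\<^sup>2)"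
  have cont: "continuous_on {0..t1} ?f"
    using assms(2) by (intro continuous_intros)
  have "M * t1 = (LINT t|lebesgue_on {0..t1}. M)"
    using assms(1) by (simp add: measure_restrict_space)
  also have "\<dots> \<le> (LINT t|lebesgue_on {0..t1}. ?f t)"
    using assms(3) cont
    by (intro integral_mono continuous_imp_integrable_real continuous_on_const) auto
  finally show ?thesis
    by (simp add: control_length_def)
qed

lemma exists_long_curve:
  assumes "0 \<le> M"
  shows "\<exists>\<gamma> \<in> Omega q0 q1. M \<le> J \<gamma>"
proof -
  define a where "a = q1$1 - q0$1"
  define b where "b = q1$2 - q0$2"
  \<comment> \<open>The planar curve is \<open>x = q0$1 + a*t + R*t*(1-t)\<close>, \<open>y = q0$2 + b*t - R*t^2*(1-t)\<close>,
    and \<open>A R\<close> is the primitive of \<open>x*y' - y*x'\<close> vanishing at \<open>0\<close>.\<close>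
  define A where "A = (\<lambda>R t. q0$1 * (b*t - R*t^2*(1-t)) - q0$2 * (a*t + R*t*(1-t))
    + R * ((b-a)*t^3/3 + a*t^4/2) - R^2 * (t^3/3 - t^4/2 + t^5/5))"
  \<comment> \<open>The constant value of the third control component: over unit time it makes up
    exactly the height that the planar motion leaves missing.\<close>
  define K where "K = (\<lambda>R. q1$3 - q0$3 - A R 1 / 2)"
  \<comment> \<open>The leading coefficient 1/60 is the area enclosed by the loop
    \<open>(t*(1-t), -t^2*(1-t))\<close>; its positive sign comes from the clockwise
    orientation.\<close>
  have K: "K R = R^2/60 - (b/6 + a/12) * R + (q1$3 - q0$3 - (q0$1*b - q0$2*a)/2)" for R
    by (simp add: K_def A_def field_simps)
  \<comment> \<open>Quadratic growth beats linear growth. The term \<open>2*R\<close> allows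
    \<open>R\<close> for the loop's contribution to each planar velocity component.\<close>
  have "eventually (\<lambda>R. \<bar>a\<bar> + \<bar>b\<bar> + 2*R + M \<le> K R) at_top"
    unfolding K by real_asymp
  then have "eventually (\<lambda>R. 0 \<le> R \<and> \<bar>a\<bar> + \<bar>b\<bar> + 2*R + M \<le> K R) at_top"
    using eventually_ge_at_top[of 0] by eventually_elim simp
  then obtain R where R: "0 \<le> R" "\<bar>a\<bar> + \<bar>b\<bar> + 2*R + M \<le> K R"
    using eventually_happens by force
  define q :: "real \<Rightarrow> point" where "q = (\<lambda>t. vector
    [q0$1 + a*t + R*t*(1-t), q0$2 + b*t - R*t^2*(1-t), q0$3 + K R * t + A R t / 2])"
  define u :: "real \<Rightarrow> real^3" where "u = (\<lambda>t. vector
    [a + R*(1-2*t), b - R*(2*t - 3*t^2), K R])"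
  have comp: "u t $ 1 = a + R*(1-2*t)" "u t $ 2 = b - R*(2*t - 3*t^2)" "u t $ 3 = K R" for t
    by (simp_all add: u_def)
  have u_cont: "continuous_on {0..1} u"
    unfolding continuous_on_componentwise[of _ u]
    by (auto simp: Basis_vec_def inner_axis comp forall_3 intro!: continuous_intros)
  have deriv: "(q has_vector_derivative velocity (q t) (u t)) (at t within {0..1})" for t
  proof (rule has_vector_derivative_vec3)
    show "((\<lambda>t. q t $ 1) has_real_derivative velocity (q t) (u t) $ 1) (at t within {0..1})"
      "((\<lambda>t. q t $ 2) has_real_derivative velocity (q t) (u t) $ 2) (at t within {0..1})"
      unfolding velocity_def X1_def X2_def X3_def q_def comp
      by (auto intro!: derivative_eq_intros simp: algebra_simps power2_eq_square)
    show "((\<lambda>t. q t $ 3) has_real_derivative velocity (q t) (u t) $ 3) (at t within {0..1})"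
      unfolding velocity_def X1_def X2_def X3_def q_def comp A_def
      by (auto intro!: derivative_eq_intros simp: field_simps power2_eq_square eval_nat_numeral)
  qed
  have timelike: "(u t $ 1)\<^sup>2 + (u t $ 2)\<^sup>2 + M\<^sup>2 \<le> (u t $ 3)\<^sup>2" if "t \<in> {0..1}" for t
  proof (rule timelike_estimate)
    have "\<bar>1 - 2*t\<bar> \<le> 1" using that by auto
    then have "\<bar>R*(1-2*t)\<bar> \<le> R"
      using R(1) by (simp add: abs_mult mult_left_le)
    moreover have "\<bar>2*t - 3*t^2\<bar> \<le> 1"
    proof -
      \<comment> \<open>This gives the lower bound \<open>2*t - 3*t^2\<close> \<ge>
        \<open>-t\<close> \<ge> \<open>-1\<close>; the upper bound comes from
        \<open>2*t - 3*t^2 = 1/3 - 3*(t - 1/3)^2\<close>.\<close>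
      have "t^2 \<le> t" using that by (simp add: power2_eq_square mult_left_le)
      moreover have "0 \<le> (t - 1/3)^2" by simp
      ultimately show ?thesis using that by (simp add: power2_eq_square algebra_simps abs_le_iff)
    qed
    then have "\<bar>R*(2*t - 3*t^2)\<bar> \<le> R"
      using R(1) by (simp add: abs_mult mult_left_le)
    ultimately show "\<bar>u t $ 1\<bar> + \<bar>u t $ 2\<bar> + M \<le> u t $ 3"
      using R(2) unfolding comp by linarith
  qed (use assms in auto)
  have "0 \<le> K R" using R assms by linarith
  have "u \<in> {0..1} \<rightarrow> U"
  proof
    fix t :: real assume "t \<in> {0..1}"
    then have "(u t $ 1)\<^sup>2 + (u t $ 2)\<^sup>2 \<le> (u t $ 3)\<^sup>2"
      using timelike[of t] zero_le_power2[of M] by linarith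
    then show "u t \<in> U"
      using \<open>0 \<le> K R\<close> by (simp add: U_def comp)
  qed
  with u_cont deriv have control: "is_control 1 q u"
    by (intro continuous_control) auto
  have "continuous_on {0..1} q"
    using deriv by (intro continuous_on_vector_derivative) auto
  then have "\<exists>L. L-lipschitz_on {0..1} q"
    using lipschitz_on_continuous_vector_derivative[OF continuous_on_velocity[OF _ u_cont] deriv]
    by blast
  moreover have "q 0 = q0" "q 1 = q1"
    by (simp_all add: q_def vec_eq_iff forall_3 a_def b_def K_def) (simp add: A_def)
  ultimately have "(1, q) \<in> Omega q0 q1"
    using control by (auto simp: Omega_def admissible_def)
  moreover have "M \<le> J (1, q)"
  proof -
    have "M * 1 \<le> control_length 1 u"
    proof (rule control_length_ge)
      fix t :: real assume "t \<in> {0..1}"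
      then show "M \<le> sqrt ((u t $ 3)\<^sup>2 - (u t $ 1)\<^sup>2 - (u t $ 2)\<^sup>2)"
        using timelike[of t] by (intro real_le_rsqrt) linarith
    qed (use u_cont in auto)
    then show ?thesis by (simp add: J_eq_control_length[OF control])
  qed
  ultimately show ?thesis by blast
qed

lemma lorentz_dist_eq_infinity: "lorentz_dist q0 q1 = \<infinity>"
proof -
  have "(SUP \<gamma>\<in>Omega q0 q1. ereal (J \<gamma>)) = \<infinity>"
  proof (rule SUP_PInfty)
    show "\<exists>\<gamma>\<in>Omega q0 q1. ereal (real n) \<le> ereal (J \<gamma>)" for n :: nat
      using exists_long_curve[of "real n" q0 q1] by simp
  qed
  \<comment> \<open>This rules out the default value 0 of the distance.\<close>
  moreover have "Omega q0 q1 \<noteq> {}"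
    using exists_long_curve[of 0 q0 q1] by auto
  ultimately show ?thesis by (simp add: lorentz_dist_def)
qed

theorem mainTheorem5:
  "(\<forall>q0 q1. lorentz_dist q0 q1 = \<infinity>) \<and> (\<forall>q0 q1. \<not> (\<exists>\<gamma>. longest_curve q0 q1 \<gamma>))"
  \<comment> \<open>Every \<open>J \<gamma>\<close> is a real number, so no curve attains an
    infinite distance.\<close>
  by (simp add: longest_curve_def lorentz_dist_eq_infinity)

end
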